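(* Let $\mathcal C$ be an essentially small category. (i) For every topology $J_1$ on $\mathcal C$, the order-preserving map $J'\mapsto J_1\cap J'$ on the ordered set of topologies of $\mathcal C$ has an adjoint $J_2\mapsto(J_1\Rightarrow J_2)$, characterized by the property that for every topology $J'$ of $\mathcal C$ $$J_1\cap J'\subseteq J_2\iff J'\subseteq(J_1\Rightarrow J_2).$$ (ii) Moreover, a family of morphisms $(X_i\xrightarrow{x_i}X)_{i\in I}$ of $\mathcal C$ with common target $X$ is covering for the topology $(J_1\Rightarrow J_2)$ if and only if, for every morphism $x:X'\to X$ of $\mathcal C$, any $J_1$-covering family $(X'_k\xrightarrow{x'_k}X')_{k\in K}$ with target $X'$ is also $J_2$-covering whenever it satisfies the following condition: every morphism $X''\to X'$ which fits into a commutative square $$\begin{array}{ccc}X''&\longrightarrow&X_i\\ \downarrow&&\downarrow{\scriptstyle x_i}\\ X'&\xrightarrow{\ x\ }&X\end{array}$$ for some $i\in I$ factors as $X''\to X'_k\xrightarrow{x'_k}X'$ for at least one $k\in K$.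
   Context: A topology on $\mathcal C$ is a Grothendieck topology. A family of morphisms with common target is covering for a topology if the sieve it generates is covering. Topologies are ordered by inclusion: $J\subseteq J'$ means that every $J$-covering sieve (or family) is $J'$-covering, and $J_1\cap J'$ is the topology whose covering sieves are those covering for both $J_1$ and $J'$. *)

theory Defs
  imports Main
begin

record ('o, 'm) cat =
  Obj :: "'o set"
  Arr :: "'m set"
  Dom :: "'m \<Rightarrow> 'o"
  Cod :: "'m \<Rightarrow> 'o"
  Ident :: "'o \<Rightarrow> 'm"
  Comp :: "'m \<Rightarrow> 'm \<Rightarrow> 'm"  (* Comp C g f is "g after f" *)

definition Hom :: "('o, 'm) cat \<Rightarrow> 'o \<Rightarrow> 'o \<Rightarrow> 'm set" where
  "Hom C X Y = {f \<in> Arr C. Dom C f = X \<and> Cod C f = Y}"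

locale category =
  fixes C :: "('o, 'm) cat"
  assumes dom_closed: "f \<in> Arr C \<Longrightarrow> Dom C f \<in> Obj C"
    and cod_closed: "f \<in> Arr C \<Longrightarrow> Cod C f \<in> Obj C"
    and ident_hom: "X \<in> Obj C \<Longrightarrow> Ident C X \<in> Hom C X X"
    and comp_hom: "f \<in> Hom C X Y \<Longrightarrow> g \<in> Hom C Y Z \<Longrightarrow> Comp C g f \<in> Hom C X Z"
    and comp_ident_left: "f \<in> Hom C X Y \<Longrightarrow> Comp C (Ident C Y) f = f"
    and comp_ident_right: "f \<in> Hom C X Y \<Longrightarrow> Comp C f (Ident C X) = f"
    and comp_assoc: "f \<in> Hom C W X \<Longrightarrow> g \<in> Hom C X Y \<Longrightarrow> h \<in> Hom C Y Z
      \<Longrightarrow> Comp C (Comp C h g) f = Comp C h (Comp C g f)"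

definition is_iso :: "('o, 'm) cat \<Rightarrow> 'm \<Rightarrow> bool" where
  "is_iso C f \<longleftrightarrow> f \<in> Arr C \<and> (\<exists>g \<in> Hom C (Cod C f) (Dom C f).
     Comp C g f = Ident C (Dom C f) \<and> Comp C f g = Ident C (Cod C f))"

(* A functor is given by its object map and its arrow map. *)
definition is_functor ::
  "('o, 'm) cat \<Rightarrow> ('p, 'n) cat \<Rightarrow> ('o \<Rightarrow> 'p) \<Rightarrow> ('m \<Rightarrow> 'n) \<Rightarrow> bool" where
  "is_functor C D Fo Fa \<longleftrightarrow>
     (\<forall>X \<in> Obj C. Fo X \<in> Obj D \<and> Fa (Ident C X) = Ident D (Fo X)) \<and>
     (\<forall>f \<in> Arr C. Fa f \<in> Hom D (Fo (Dom C f)) (Fo (Cod C f))) \<and>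
     (\<forall>X Y Z. \<forall>f \<in> Hom C X Y. \<forall>g \<in> Hom C Y Z.
        Fa (Comp C g f) = Comp D (Fa g) (Fa f))"

definition is_natural_iso ::
  "('o, 'm) cat \<Rightarrow> ('p, 'n) cat \<Rightarrow> ('o \<Rightarrow> 'p) \<Rightarrow> ('m \<Rightarrow> 'n) \<Rightarrow> ('o \<Rightarrow> 'p) \<Rightarrow> ('m \<Rightarrow> 'n)
    \<Rightarrow> ('o \<Rightarrow> 'n) \<Rightarrow> bool" where
  "is_natural_iso C D Fo Fa Go Ga \<eta> \<longleftrightarrow>
     (\<forall>X \<in> Obj C. \<eta> X \<in> Hom D (Fo X) (Go X) \<and> is_iso D (\<eta> X)) \<and>
     (\<forall>f \<in> Arr C. Comp D (\<eta> (Cod C f)) (Fa f) = Comp D (Ga f) (\<eta> (Dom C f)))"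

definition equivalent_categories :: "('o, 'm) cat \<Rightarrow> ('p, 'n) cat \<Rightarrow> bool" where
  "equivalent_categories C D \<longleftrightarrow> (\<exists>Fo Fa Go Ga \<eta> \<epsilon>.
     is_functor C D Fo Fa \<and> is_functor D C Go Ga \<and>
     is_natural_iso C C id id (Go \<circ> Fo) (Ga \<circ> Fa) \<eta> \<and>
     is_natural_iso D D (Fo \<circ> Go) (Fa \<circ> Ga) id id \<epsilon>)"

(* HOL has no set/class distinction, so size is measured relative to a type 'u:
   the small sets are those in bijection with a subset of 'u. A small category is,
   up to isomorphism, one whose objects and arrows are elements of 'u. The types
   'o and 'm of the category itself are unrestricted, and small families are
   indexed by sets of type 'u set. *)
definition essentially_small :: "'u itself \<Rightarrow> ('o, 'm) cat \<Rightarrow> bool" where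
  "essentially_small U C \<longleftrightarrow>
     (\<exists>D :: ('u, 'u) cat. category D \<and> equivalent_categories C D)"

definition is_sieve :: "('o, 'm) cat \<Rightarrow> 'o \<Rightarrow> 'm set \<Rightarrow> bool" where
  "is_sieve C X S \<longleftrightarrow> S \<subseteq> {f \<in> Arr C. Cod C f = X} \<and>
     (\<forall>f \<in> S. \<forall>g \<in> Arr C. Cod C g = Dom C f \<longrightarrow> Comp C f g \<in> S)"

definition pullback_sieve :: "('o, 'm) cat \<Rightarrow> 'm \<Rightarrow> 'm set \<Rightarrow> 'm set" where
  "pullback_sieve C f S = {g \<in> Arr C. Cod C g = Dom C f \<and> Comp C f g \<in> S}"

(* A topology is the set of pairs (X, S) with S a covering sieve on the object X.
   The object is recorded because the empty sieve does not determine it. Inclusion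
   and intersection of topologies are then the set operations. *)
definition grothendieck_topology :: "('o, 'm) cat \<Rightarrow> ('o \<times> 'm set) set \<Rightarrow> bool" where
  "grothendieck_topology C J \<longleftrightarrow>
     (\<forall>(X, S) \<in> J. X \<in> Obj C \<and> is_sieve C X S) \<and>
     (\<forall>X \<in> Obj C. (X, {f \<in> Arr C. Cod C f = X}) \<in> J) \<and>
     (\<forall>(X, S) \<in> J. \<forall>f \<in> Arr C. Cod C f = X \<longrightarrow> (Dom C f, pullback_sieve C f S) \<in> J) \<and>
     (\<forall>(X, S) \<in> J. \<forall>R. is_sieve C X R \<longrightarrow>
        (\<forall>f \<in> S. (Dom C f, pullback_sieve C f R) \<in> J) \<longrightarrow> (X, R) \<in> J)"

definition is_family :: "('o, 'm) cat \<Rightarrow> 'o \<Rightarrow> 'i set \<Rightarrow> ('i \<Rightarrow> 'm) \<Rightarrow> bool" where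
  "is_family C X I x \<longleftrightarrow> X \<in> Obj C \<and> (\<forall>i \<in> I. x i \<in> Arr C \<and> Cod C (x i) = X)"

definition generated_sieve :: "('o, 'm) cat \<Rightarrow> 'i set \<Rightarrow> ('i \<Rightarrow> 'm) \<Rightarrow> 'm set" where
  "generated_sieve C I x =
     {Comp C (x i) g | i g. i \<in> I \<and> g \<in> Arr C \<and> Cod C g = Dom C (x i)}"

definition covering_family ::
  "('o, 'm) cat \<Rightarrow> ('o \<times> 'm set) set \<Rightarrow> 'o \<Rightarrow> 'i set \<Rightarrow> ('i \<Rightarrow> 'm) \<Rightarrow> bool" where
  "covering_family C J X I x \<longleftrightarrow> is_family C X I x \<and> (X, generated_sieve C I x) \<in> J"

definition topology_imp ::
  "('o, 'm) cat \<Rightarrow> ('o \<times> 'm set) set \<Rightarrow> ('o \<times> 'm set) set \<Rightarrow> ('o \<times> 'm set) set" where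
  "topology_imp C J1 J2 = (THE J. grothendieck_topology C J \<and>
     (\<forall>J'. grothendieck_topology C J' \<longrightarrow> (J1 \<inter> J' \<subseteq> J2 \<longleftrightarrow> J' \<subseteq> J)))"

end

theory Submission
  imports Defs
begin

text \<open>
  Topologies on a category behave like the elements of a Heyting algebra, and the implication
  \<open>J1 \<Rightarrow> J2\<close> can be written down directly. If \<open>S\<close> covers for a topology \<open>J'\<close> with
  \<open>J1 \<inter> J' \<subseteq> J2\<close>, then every sieve \<open>T\<close> that contains a pullback of \<open>S\<close> covers for \<open>J'\<close>, so it
  covers for \<open>J2\<close> as soon as it covers for \<open>J1\<close>. Turning this necessary condition into a
  definition gives \<open>residual\<close>, which therefore contains all such \<open>J'\<close>; testing the condition
  with the identity and \<open>T = S\<close> shows that \<open>J1 \<inter> residual J1 J2 \<subseteq> J2\<close>. The one substantial point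
  is that \<open>residual\<close> is itself a topology (\<open>residual_is_topology\<close>), and there the transitivity
  axiom carries the weight: a \<open>J1\<close>-covering \<open>T\<close> is compared with the larger \<open>T \<union> y\<^sup>*S\<close>.

  The description by covering families is the same condition with \<open>S\<close> and \<open>T\<close> replaced by families
  generating them: the square condition says that \<open>y\<close> pulls the sieve generated by the \<open>x\<^sub>i\<close> back
  into the sieve generated by the \<open>x'\<^sub>k\<close>. What remains is that small families generate all sieves.
  This is where essential smallness enters (\<open>sieve_generated_by_small_family\<close>).
\<close>

section \<open>Sieves and topologies\<close>

definition maximal_sieve :: "('o, 'm) cat \<Rightarrow> 'o \<Rightarrow> 'm set" where
  "maximal_sieve C X = {f \<in> Arr C. Cod C f = X}"

definition residual ::
  "('o, 'm) cat \<Rightarrow> ('o \<times> 'm set) set \<Rightarrow> ('o \<times> 'm set) set \<Rightarrow> ('o \<times> 'm set) set" where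
  "residual C J1 J2 = {(X, S). X \<in> Obj C \<and> is_sieve C X S \<and>
     (\<forall>y T. y \<in> Arr C \<longrightarrow> Cod C y = X \<longrightarrow> (Dom C y, T) \<in> J1 \<longrightarrow>
        pullback_sieve C y S \<subseteq> T \<longrightarrow> (Dom C y, T) \<in> J2)}"

lemma topology_obj: "grothendieck_topology C J \<Longrightarrow> (X, S) \<in> J \<Longrightarrow> X \<in> Obj C"
  unfolding grothendieck_topology_def by blast

lemma topology_sieve: "grothendieck_topology C J \<Longrightarrow> (X, S) \<in> J \<Longrightarrow> is_sieve C X S"
  unfolding grothendieck_topology_def by blast

lemma topology_maximal:
  "grothendieck_topology C J \<Longrightarrow> X \<in> Obj C \<Longrightarrow> (X, maximal_sieve C X) \<in> J"
  unfolding grothendieck_topology_def maximal_sieve_def by blast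

lemma topology_pullback:
  "grothendieck_topology C J \<Longrightarrow> (X, S) \<in> J \<Longrightarrow> f \<in> Arr C \<Longrightarrow> Cod C f = X
    \<Longrightarrow> (Dom C f, pullback_sieve C f S) \<in> J"
  unfolding grothendieck_topology_def by blast

lemma topology_trans:
  assumes "grothendieck_topology C J" "(X, S) \<in> J" "is_sieve C X R"
    and "\<And>f. f \<in> S \<Longrightarrow> (Dom C f, pullback_sieve C f R) \<in> J"
  shows "(X, R) \<in> J"
  using assms unfolding grothendieck_topology_def by fast

lemma sieve_arrow: "is_sieve C X S \<Longrightarrow> f \<in> S \<Longrightarrow> f \<in> Arr C \<and> Cod C f = X"
  unfolding is_sieve_def by blast

lemma sieve_comp:
  "is_sieve C X S \<Longrightarrow> f \<in> S \<Longrightarrow> g \<in> Arr C \<Longrightarrow> Cod C g = Dom C f \<Longrightarrow> Comp C f g \<in> S"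
  unfolding is_sieve_def by blast

lemma sieve_union: "is_sieve C X S \<Longrightarrow> is_sieve C X T \<Longrightarrow> is_sieve C X (S \<union> T)"
  unfolding is_sieve_def by blast

lemma topology_Int:
  assumes J1: "grothendieck_topology C J1" and J2: "grothendieck_topology C J2"
  shows "grothendieck_topology C (J1 \<inter> J2)"
  unfolding grothendieck_topology_def
proof (intro conjI)
  show "\<forall>(X, S) \<in> J1 \<inter> J2. X \<in> Obj C \<and> is_sieve C X S"
    using topology_obj[OF J1] topology_sieve[OF J1] by blast
  show "\<forall>X \<in> Obj C. (X, {f \<in> Arr C. Cod C f = X}) \<in> J1 \<inter> J2"
    using topology_maximal[OF J1] topology_maximal[OF J2] by (auto simp: maximal_sieve_def)
  show "\<forall>(X, S) \<in> J1 \<inter> J2. \<forall>f \<in> Arr C. Cod C f = X \<longrightarrow>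
      (Dom C f, pullback_sieve C f S) \<in> J1 \<inter> J2"
    using topology_pullback[OF J1] topology_pullback[OF J2] by blast
  show "\<forall>(X, S) \<in> J1 \<inter> J2. \<forall>R. is_sieve C X R \<longrightarrow>
      (\<forall>f \<in> S. (Dom C f, pullback_sieve C f R) \<in> J1 \<inter> J2) \<longrightarrow> (X, R) \<in> J1 \<inter> J2"
    using topology_trans[OF J1] topology_trans[OF J2] by (auto split: prod.splits)
qed

lemma residual_mono: "J2 \<subseteq> J2' \<Longrightarrow> residual C J1 J2 \<subseteq> residual C J1 J2'"
  unfolding residual_def by blast

context category
begin

lemma Arr_comp:
  assumes "f \<in> Arr C" "g \<in> Arr C" "Cod C g = Dom C f"
  shows "Comp C f g \<in> Arr C" "Dom C (Comp C f g) = Dom C g" "Cod C (Comp C f g) = Cod C f"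
  using comp_hom[of g "Dom C g" "Dom C f" f "Cod C f"] assms by (auto simp: Hom_def)

lemma Arr_assoc:
  assumes "f \<in> Arr C" "g \<in> Arr C" "h \<in> Arr C" "Cod C f = Dom C g" "Cod C g = Dom C h"
  shows "Comp C (Comp C h g) f = Comp C h (Comp C g f)"
  using comp_assoc[of f "Dom C f" "Dom C g" g "Dom C h" h "Cod C h"] assms by (auto simp: Hom_def)

lemma pullback_is_sieve:
  assumes "is_sieve C X S" "f \<in> Arr C" "Cod C f = X"
  shows "is_sieve C (Dom C f) (pullback_sieve C f S)"
  using assms sieve_comp[OF assms(1)]
  unfolding is_sieve_def[of _ "Dom C f"] pullback_sieve_def
  by (auto simp: Arr_comp Arr_assoc[symmetric])

lemma pullback_comp:
  assumes "f \<in> Arr C" "g \<in> Arr C" "Cod C g = Dom C f"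
  shows "pullback_sieve C (Comp C f g) S = pullback_sieve C g (pullback_sieve C f S)"
  using assms unfolding pullback_sieve_def by (auto simp: Arr_comp Arr_assoc)

lemma pullback_ident:
  assumes "X \<in> Obj C" "is_sieve C X S"
  shows "pullback_sieve C (Ident C X) S = S"
  using assms ident_hom[OF assms(1)] comp_ident_left
  unfolding pullback_sieve_def is_sieve_def Hom_def by auto

lemma pullback_member:
  assumes "is_sieve C X S" "f \<in> S"
  shows "pullback_sieve C f S = maximal_sieve C (Dom C f)"
  using sieve_comp[OF assms] unfolding pullback_sieve_def maximal_sieve_def by blast

lemma topology_superset:
  assumes J: "grothendieck_topology C J" and S: "(X, S) \<in> J"
    and R: "is_sieve C X R" and sub: "S \<subseteq> R"
  shows "(X, R) \<in> J"
proof (rule topology_trans[OF J S R])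
  fix f assume "f \<in> S"
  then have f: "f \<in> R" using sub by blast
  have "Dom C f \<in> Obj C" using sieve_arrow[OF R f] dom_closed by blast
  then show "(Dom C f, pullback_sieve C f R) \<in> J"
    using topology_maximal[OF J] by (simp add: pullback_member[OF R f])
qed

section \<open>The residual of two topologies\<close>

lemma residual_ident:
  assumes S: "(X, S) \<in> residual C J1 J2" and T: "(X, T) \<in> J1" and sub: "S \<subseteq> T"
  shows "(X, T) \<in> J2"
proof -
  have X: "X \<in> Obj C" and sieve: "is_sieve C X S" using S by (auto simp: residual_def)
  have "Ident C X \<in> Arr C" "Cod C (Ident C X) = X" "Dom C (Ident C X) = X"
    using ident_hom[OF X] by (auto simp: Hom_def)
  then show ?thesis
    using S T sub pullback_ident[OF X sieve] unfolding residual_def by force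
qed

text \<open>
  Transitivity is the essential axiom. Let \<open>S\<close> be in the residual and let \<open>R\<close> be locally in it
  along \<open>S\<close>; let \<open>T\<close> be \<open>J1\<close>-covering and contain \<open>y\<^sup>*R\<close>. The hypothesis on \<open>S\<close> says nothing
  about \<open>T\<close>, but it applies to the \<open>J1\<close>-covering sieve \<open>T \<union> y\<^sup>*S\<close>, which is therefore
  \<open>J2\<close>-covering. Along an arrow of \<open>T\<close> the pullback of \<open>T\<close> is maximal, and along an arrow \<open>g\<close> of
  \<open>y\<^sup>*S\<close> it contains \<open>(yg)\<^sup>*R\<close>, a residual sieve; so \<open>T\<close> is locally \<open>J2\<close>-covering along a
  \<open>J2\<close>-covering sieve.
\<close>

lemma residual_trans:
  assumes J1: "grothendieck_topology C J1" and J2: "grothendieck_topology C J2"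
    and S: "(X, S) \<in> residual C J1 J2" and R: "is_sieve C X R"
    and local: "\<And>f. f \<in> S \<Longrightarrow> (Dom C f, pullback_sieve C f R) \<in> residual C J1 J2"
  shows "(X, R) \<in> residual C J1 J2"
proof -
  have X: "X \<in> Obj C" and S_sieve: "is_sieve C X S" using S by (auto simp: residual_def)
  have "(Dom C y, T) \<in> J2"
    if y: "y \<in> Arr C" "Cod C y = X" and T: "(Dom C y, T) \<in> J1"
      and sub: "pullback_sieve C y R \<subseteq> T" for y T
  proof -
    let ?yS = "pullback_sieve C y S"
    have T_sieve: "is_sieve C (Dom C y) T" using topology_sieve[OF J1 T] .
    have "is_sieve C (Dom C y) (T \<union> ?yS)"
      using sieve_union[OF T_sieve pullback_is_sieve[OF S_sieve y]] .
    then have "(Dom C y, T \<union> ?yS) \<in> J1"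
      using topology_superset[OF J1 T] by blast
    then have big: "(Dom C y, T \<union> ?yS) \<in> J2"
      using S y unfolding residual_def by blast
    show ?thesis
    proof (rule topology_trans[OF J2 big T_sieve])
      fix g assume "g \<in> T \<union> ?yS"
      then consider "g \<in> T" | "g \<in> ?yS" by blast
      then show "(Dom C g, pullback_sieve C g T) \<in> J2"
      proof cases
        case 1
        have "Dom C g \<in> Obj C" using sieve_arrow[OF T_sieve 1] dom_closed by blast
        then show ?thesis
          using topology_maximal[OF J2] by (simp add: pullback_member[OF T_sieve 1])
      next
        case 2
        then have g: "g \<in> Arr C" "Cod C g = Dom C y" "Comp C y g \<in> S"
          by (auto simp: pullback_sieve_def)
        have "(Dom C g, pullback_sieve C g (pullback_sieve C y R)) \<in> residual C J1 J2"
          using local[OF g(3)] y g by (simp add: Arr_comp pullback_comp)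
        moreover have "(Dom C g, pullback_sieve C g T) \<in> J1"
          using topology_pullback[OF J1 T g(1,2)] .
        moreover have "pullback_sieve C g (pullback_sieve C y R) \<subseteq> pullback_sieve C g T"
          using sub by (auto simp: pullback_sieve_def)
        ultimately show ?thesis by (rule residual_ident)
      qed
    qed
  qed
  then show ?thesis using X R unfolding residual_def by blast
qed

lemma residual_is_topology:
  assumes J1: "grothendieck_topology C J1" and J2: "grothendieck_topology C J2"
  shows "grothendieck_topology C (residual C J1 J2)"
  unfolding grothendieck_topology_def
proof (intro conjI)
  show "\<forall>(X, S) \<in> residual C J1 J2. X \<in> Obj C \<and> is_sieve C X S"
    by (auto simp: residual_def)
  show "\<forall>X \<in> Obj C. (X, {f \<in> Arr C. Cod C f = X}) \<in> residual C J1 J2"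
  proof
    fix X assume X: "X \<in> Obj C"
    have "(Dom C y, T) \<in> J2"
      if y: "y \<in> Arr C" "Cod C y = X" and T: "(Dom C y, T) \<in> J1"
        and sub: "pullback_sieve C y (maximal_sieve C X) \<subseteq> T" for y T
    proof -
      have "maximal_sieve C (Dom C y) \<subseteq> T"
        using sub y by (auto simp: pullback_sieve_def maximal_sieve_def Arr_comp)
      moreover have "T \<subseteq> maximal_sieve C (Dom C y)"
        using sieve_arrow[OF topology_sieve[OF J1 T]] by (auto simp: maximal_sieve_def)
      ultimately have "T = maximal_sieve C (Dom C y)" by blast
      then show ?thesis using topology_maximal[OF J2] dom_closed[OF y(1)] by simp
    qed
    moreover have "is_sieve C X (maximal_sieve C X)"
      using topology_sieve[OF J1 topology_maximal[OF J1 X]] .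
    ultimately show "(X, {f \<in> Arr C. Cod C f = X}) \<in> residual C J1 J2"
      using X unfolding residual_def maximal_sieve_def by blast
  qed
  show "\<forall>(X, S) \<in> residual C J1 J2. \<forall>f \<in> Arr C. Cod C f = X \<longrightarrow>
      (Dom C f, pullback_sieve C f S) \<in> residual C J1 J2"
  proof clarify
    fix S f assume S: "(Cod C f, S) \<in> residual C J1 J2" and f: "f \<in> Arr C"
    have "(Dom C y, T) \<in> J2"
      if y: "y \<in> Arr C" "Cod C y = Dom C f" and T: "(Dom C y, T) \<in> J1"
        and sub: "pullback_sieve C y (pullback_sieve C f S) \<subseteq> T" for y T
    proof -
      note fy = Arr_comp[OF f y]
      have "(Dom C (Comp C f y), T) \<in> J1" "pullback_sieve C (Comp C f y) S \<subseteq> T"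
        using T sub fy pullback_comp[OF f y] by auto
      then have "(Dom C (Comp C f y), T) \<in> J2"
        using S fy unfolding residual_def by blast
      then show ?thesis using fy by simp
    qed
    then show "(Dom C f, pullback_sieve C f S) \<in> residual C J1 J2"
      using S f dom_closed[OF f] pullback_is_sieve[of "Cod C f" S f] unfolding residual_def by blast
  qed
  show "\<forall>(X, S) \<in> residual C J1 J2. \<forall>R. is_sieve C X R \<longrightarrow>
      (\<forall>f \<in> S. (Dom C f, pullback_sieve C f R) \<in> residual C J1 J2) \<longrightarrow>
      (X, R) \<in> residual C J1 J2"
    using residual_trans[OF J1 J2] by blast
qed

lemma residual_adjunction:
  assumes J1: "grothendieck_topology C J1" and J': "grothendieck_topology C J'"
  shows "J1 \<inter> J' \<subseteq> J2 \<longleftrightarrow> J' \<subseteq> residual C J1 J2"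
proof
  assume le: "J1 \<inter> J' \<subseteq> J2"
  show "J' \<subseteq> residual C J1 J2"
  proof clarify
    fix X S assume S: "(X, S) \<in> J'"
    have "(Dom C y, T) \<in> J2"
      if y: "y \<in> Arr C" "Cod C y = X" and T: "(Dom C y, T) \<in> J1"
        and sub: "pullback_sieve C y S \<subseteq> T" for y T
      using topology_superset[OF J' topology_pullback[OF J' S y] topology_sieve[OF J1 T] sub] T le
      by blast
    then show "(X, S) \<in> residual C J1 J2"
      using topology_obj[OF J' S] topology_sieve[OF J' S] unfolding residual_def by blast
  qed
next
  assume le: "J' \<subseteq> residual C J1 J2"
  show "J1 \<inter> J' \<subseteq> J2"
  proof clarify
    fix X S assume "(X, S) \<in> J1" "(X, S) \<in> J'"
    then show "(X, S) \<in> J2" using le residual_ident by blast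
  qed
qed

lemma residual_unique:
  assumes J1: "grothendieck_topology C J1" and J2: "grothendieck_topology C J2"
  shows "grothendieck_topology C J \<and>
      (\<forall>J'. grothendieck_topology C J' \<longrightarrow> (J1 \<inter> J' \<subseteq> J2 \<longleftrightarrow> J' \<subseteq> J))
    \<longleftrightarrow> J = residual C J1 J2"
  using residual_is_topology[OF J1 J2] residual_adjunction[OF J1] by blast

lemma topology_imp_eq_residual:
  assumes "grothendieck_topology C J1" "grothendieck_topology C J2"
  shows "topology_imp C J1 J2 = residual C J1 J2"
  unfolding topology_imp_def residual_unique[OF assms] by simp

section \<open>Families and the sieves they generate\<close>

lemma generated_is_sieve:
  assumes "is_family C X I x"
  shows "is_sieve C X (generated_sieve C I x)"
proof -
  have "Comp C f h \<in> generated_sieve C I x"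
    if f: "f \<in> generated_sieve C I x" and h: "h \<in> Arr C" "Cod C h = Dom C f" for f h
  proof -
    obtain i g where ig: "i \<in> I" "g \<in> Arr C" "Cod C g = Dom C (x i)" "f = Comp C (x i) g"
      using f by (auto simp: generated_sieve_def)
    have xi: "x i \<in> Arr C" using assms ig(1) by (simp add: is_family_def)
    have "Comp C f h = Comp C (x i) (Comp C g h)"
      using ig xi h by (simp add: Arr_comp Arr_assoc)
    then show ?thesis
      using ig xi h unfolding generated_sieve_def by (force simp: Arr_comp)
  qed
  then show ?thesis
    using assms unfolding is_sieve_def by (auto simp: generated_sieve_def is_family_def Arr_comp)
qed

lemma generated_sieve_iff_factors:
  assumes "is_family C X I x" "f \<in> Hom C Y X"
  shows "f \<in> generated_sieve C I x \<longleftrightarrow>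
    (\<exists>i \<in> I. \<exists>g \<in> Hom C Y (Dom C (x i)). Comp C (x i) g = f)"
proof
  assume "f \<in> generated_sieve C I x"
  then obtain i g where "i \<in> I" "g \<in> Arr C" "Cod C g = Dom C (x i)" "f = Comp C (x i) g"
    by (auto simp: generated_sieve_def)
  moreover from this have "Dom C g = Y"
    using assms Arr_comp(2)[of "x i" g] by (simp add: is_family_def Hom_def)
  ultimately show "\<exists>i \<in> I. \<exists>g \<in> Hom C Y (Dom C (x i)). Comp C (x i) g = f"
    by (auto simp: Hom_def)
qed (auto simp: generated_sieve_def Hom_def)

text \<open>
  The square condition of the theorem in terms of sieves: the top arrow \<open>g\<close> of a square exhibits
  \<open>y \<circ> f\<close> as a member of the sieve generated by \<open>x\<close>.
\<close>

lemma square_condition_iff_pullback_subset: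
  assumes x: "is_family C X I x" and x': "is_family C X' K x'" and y: "y \<in> Hom C X' X"
  shows "(\<forall>X''. \<forall>f \<in> Hom C X'' X'.
      (\<exists>i \<in> I. \<exists>g \<in> Hom C X'' (Dom C (x i)). Comp C (x i) g = Comp C y f) \<longrightarrow>
      (\<exists>k \<in> K. \<exists>h \<in> Hom C X'' (Dom C (x' k)). f = Comp C (x' k) h))
    \<longleftrightarrow> pullback_sieve C y (generated_sieve C I x) \<subseteq> generated_sieve C K x'"
proof -
  have "(\<exists>i \<in> I. \<exists>g \<in> Hom C X'' (Dom C (x i)). Comp C (x i) g = Comp C y f) \<longleftrightarrow>
      f \<in> pullback_sieve C y (generated_sieve C I x)"
    and "(\<exists>k \<in> K. \<exists>h \<in> Hom C X'' (Dom C (x' k)). f = Comp C (x' k) h) \<longleftrightarrow>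
      f \<in> generated_sieve C K x'"
    if f: "f \<in> Hom C X'' X'" for X'' f
    using generated_sieve_iff_factors[OF x comp_hom[OF f y]]
      generated_sieve_iff_factors[OF x' f] f y
    by (auto simp: pullback_sieve_def Hom_def eq_commute)
  then show ?thesis
    by (auto simp: subset_iff pullback_sieve_def Hom_def) (use y in \<open>auto simp: Hom_def\<close>)
qed

text \<open>
  A small category \<open>D\<close> with functors \<open>F\<close>, \<open>G\<close> and \<open>\<eta> : id \<cong> G F\<close> has few enough arrows to index a
  generating family. Naturality gives \<open>f = (\<eta>\<^sub>X\<^sup>-\<^sup>1 \<circ> G F f) \<circ> \<eta>\<^sub>Y\<close> for every \<open>f : Y \<rightarrow> X\<close>, so \<open>f\<close> generates the
  same sieve as \<open>\<eta>\<^sub>X\<^sup>-\<^sup>1 \<circ> G F f\<close>, an arrow that depends only on the arrow \<open>F f\<close> of \<open>D\<close>.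
\<close>

lemma sieve_generated_by_small_family:
  assumes small: "essentially_small TYPE('u) C" and X: "X \<in> Obj C" and T: "is_sieve C X T"
  obtains K :: "'u set" and x where "is_family C X K x" "generated_sieve C K x = T"
proof -
  obtain D :: "('u, 'u) cat" and Fo Fa Go Ga \<eta> where
    F: "is_functor C D Fo Fa" and G: "is_functor D C Go Ga"
    and nat: "is_natural_iso C C id id (Go \<circ> Fo) (Ga \<circ> Fa) \<eta>"
    using small unfolding essentially_small_def equivalent_categories_def by blast
  have eta: "\<eta> Y \<in> Arr C" "Dom C (\<eta> Y) = Y" "Cod C (\<eta> Y) = Go (Fo Y)" "is_iso C (\<eta> Y)"
    if "Y \<in> Obj C" for Y
    using nat that by (auto simp: is_natural_iso_def Hom_def)
  have natural: "Comp C (\<eta> (Cod C f)) f = Comp C (Ga (Fa f)) (\<eta> (Dom C f))" if "f \<in> Arr C" for f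
    using nat that by (simp add: is_natural_iso_def)
  have GF: "Ga (Fa f) \<in> Arr C" "Dom C (Ga (Fa f)) = Go (Fo (Dom C f))"
    "Cod C (Ga (Fa f)) = Go (Fo (Cod C f))" if "f \<in> Arr C" for f
    using F G that by (auto simp: is_functor_def Hom_def)
  obtain \<theta> where theta: "\<theta> \<in> Arr C" "Dom C \<theta> = Go (Fo X)" "Cod C \<theta> = X"
    and theta_eta: "Comp C \<theta> (\<eta> X) = Ident C X"
    using eta[OF X] by (auto simp: is_iso_def Hom_def)
  define x where "x d = Comp C \<theta> (Ga d)" for d
  \<comment> \<open>a \<open>d\<close> outside \<open>D\<close> may be an index too; this is harmless, as \<open>x d \<in> T\<close> is all that matters\<close>
  define K where "K = {d. x d \<in> T}"
  have family: "is_family C X K x"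
    using X sieve_arrow[OF T] by (auto simp: is_family_def K_def)
  moreover have "generated_sieve C K x = T"
  proof
    show "generated_sieve C K x \<subseteq> T"
      using sieve_comp[OF T] by (auto simp: generated_sieve_def K_def)
    show "T \<subseteq> generated_sieve C K x"
    proof
      fix f assume fT: "f \<in> T"
      have f: "f \<in> Arr C" "Cod C f = X" using sieve_arrow[OF T fT] by auto
      have Y: "Dom C f \<in> Obj C" using dom_closed[OF f(1)] .
      note etaY = eta[OF Y] and etaX = eta[OF X] and GFf = GF[OF f(1)]
      obtain \<iota> where iota: "\<iota> \<in> Arr C" "Dom C \<iota> = Go (Fo (Dom C f))" "Cod C \<iota> = Dom C f"
        and eta_iota: "Comp C (\<eta> (Dom C f)) \<iota> = Ident C (Go (Fo (Dom C f)))"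
        using etaY by (auto simp: is_iso_def Hom_def)
      have xF: "x (Fa f) \<in> Arr C" "Dom C (x (Fa f)) = Go (Fo (Dom C f))" "Cod C (x (Fa f)) = X"
        using theta GFf f by (auto simp: x_def Arr_comp)
      have "Comp C (x (Fa f)) (\<eta> (Dom C f)) = Comp C \<theta> (Comp C (\<eta> X) f)"
        using theta GFf etaY f natural[OF f(1)] by (simp add: x_def Arr_assoc)
      also have "\<dots> = Comp C (Comp C \<theta> (\<eta> X)) f"
        using theta etaX f by (simp add: Arr_assoc)
      also have "\<dots> = f"
        using theta_eta f comp_ident_left[of f "Dom C f" X] by (simp add: Hom_def)
      finally have factor: "f = Comp C (x (Fa f)) (\<eta> (Dom C f))" by simp
      \<comment> \<open>conversely, \<open>x (F f)\<close> is a multiple of \<open>f\<close>, so it lies in the sieve \<open>T\<close>\<close>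
      have "Comp C f \<iota> = Comp C (Comp C (x (Fa f)) (\<eta> (Dom C f))) \<iota>"
        using factor by simp
      also have "\<dots> = Comp C (x (Fa f)) (Comp C (\<eta> (Dom C f)) \<iota>)"
        using xF etaY iota by (simp add: Arr_assoc)
      also have "\<dots> = x (Fa f)"
        using eta_iota xF comp_ident_right[of "x (Fa f)" "Go (Fo (Dom C f))" X] by (simp add: Hom_def)
      finally have "x (Fa f) \<in> T"
        using sieve_comp[OF T fT] iota by metis
      then show "f \<in> generated_sieve C K x"
        using factor etaY xF unfolding generated_sieve_def K_def by fastforce
    qed
  qed
  ultimately show thesis by (rule that)
qed

lemma covering_family_residual_iff:
  fixes I :: "'u set"
  assumes small: "essentially_small TYPE('u) C"
    and J1: "grothendieck_topology C J1" and x: "is_family C X I x"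
  shows "covering_family C (residual C J1 J2) X I x \<longleftrightarrow>
    (\<forall>X'. \<forall>y \<in> Hom C X' X. \<forall>(K :: 'u set) x'. covering_family C J1 X' K x' \<longrightarrow>
       pullback_sieve C y (generated_sieve C I x) \<subseteq> generated_sieve C K x' \<longrightarrow>
       covering_family C J2 X' K x')" (is "_ \<longleftrightarrow> ?families")
proof
  assume "covering_family C (residual C J1 J2) X I x"
  then show ?families
    unfolding covering_family_def residual_def Hom_def by blast
next
  assume fam: ?families
  have "(Dom C y, T) \<in> J2"
    if y: "y \<in> Arr C" "Cod C y = X" and T: "(Dom C y, T) \<in> J1"
      and sub: "pullback_sieve C y (generated_sieve C I x) \<subseteq> T" for y T
  proof -
    obtain K :: "'u set" and x' where K: "is_family C (Dom C y) K x'" "generated_sieve C K x' = T"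
      using sieve_generated_by_small_family[OF small topology_obj[OF J1 T] topology_sieve[OF J1 T]] .
    have "covering_family C J2 (Dom C y) K x'"
      using fam y K T sub unfolding covering_family_def Hom_def by blast
    then show ?thesis using K by (simp add: covering_family_def)
  qed
  moreover have "X \<in> Obj C" using x by (simp add: is_family_def)
  ultimately show "covering_family C (residual C J1 J2) X I x"
    using x generated_is_sieve[OF x] unfolding covering_family_def residual_def by blast
qed

end

section \<open>Implication of topologies\<close>

theorem propositionI3p4:
  fixes C :: "('o, 'm) cat"
  assumes "category C"
    and "essentially_small TYPE('u) C"
  shows
    "(\<forall>J1. grothendieck_topology C J1 \<longrightarrow>
        (\<forall>J'. grothendieck_topology C J' \<longrightarrow> grothendieck_topology C (J1 \<inter> J')) \<and>
        mono_on {J'. grothendieck_topology C J'} (\<lambda>J'. J1 \<inter> J') \<and>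
        mono_on {J2. grothendieck_topology C J2} (\<lambda>J2. topology_imp C J1 J2) \<and>
        (\<forall>J2. grothendieck_topology C J2 \<longrightarrow>
           (\<exists>!J. grothendieck_topology C J \<and>
              (\<forall>J'. grothendieck_topology C J' \<longrightarrow> (J1 \<inter> J' \<subseteq> J2 \<longleftrightarrow> J' \<subseteq> J))) \<and>
           grothendieck_topology C (topology_imp C J1 J2) \<and>
           (\<forall>J'. grothendieck_topology C J' \<longrightarrow>
              (J1 \<inter> J' \<subseteq> J2 \<longleftrightarrow> J' \<subseteq> topology_imp C J1 J2))))
     \<and>
     (\<forall>J1 J2. grothendieck_topology C J1 \<longrightarrow> grothendieck_topology C J2 \<longrightarrow>
        (\<forall>X (I :: 'u set) x. is_family C X I x \<longrightarrow>
           (covering_family C (topology_imp C J1 J2) X I x \<longleftrightarrow>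
              (\<forall>X'. \<forall>y \<in> Hom C X' X. \<forall>(K :: 'u set) x'.
                 covering_family C J1 X' K x' \<longrightarrow>
                 (\<forall>X''. \<forall>f \<in> Hom C X'' X'.
                    (\<exists>i \<in> I. \<exists>g \<in> Hom C X'' (Dom C (x i)). Comp C (x i) g = Comp C y f) \<longrightarrow>
                    (\<exists>k \<in> K. \<exists>h \<in> Hom C X'' (Dom C (x' k)). f = Comp C (x' k) h)) \<longrightarrow>
                 covering_family C J2 X' K x'))))"
proof -
  interpret category C by fact
  show ?thesis
  proof (intro conjI allI impI)
    fix J1 J' assume "grothendieck_topology C J1" "grothendieck_topology C J'"
    then show "grothendieck_topology C (J1 \<inter> J')" by (rule topology_Int)
  next
    fix J1 :: "('o \<times> 'm set) set"
    show "mono_on {J'. grothendieck_topology C J'} (\<lambda>J'. J1 \<inter> J')"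
      by (auto intro!: mono_onI)
  next
    fix J1 assume "grothendieck_topology C J1"
    then show "mono_on {J2. grothendieck_topology C J2} (\<lambda>J2. topology_imp C J1 J2)"
      by (intro mono_onI) (simp add: topology_imp_eq_residual residual_mono)
  next
    fix J1 J2 assume J: "grothendieck_topology C J1" "grothendieck_topology C J2"
    show "\<exists>!J. grothendieck_topology C J \<and>
        (\<forall>J'. grothendieck_topology C J' \<longrightarrow> (J1 \<inter> J' \<subseteq> J2 \<longleftrightarrow> J' \<subseteq> J))"
      unfolding residual_unique[OF J] by simp
    show "grothendieck_topology C (topology_imp C J1 J2)"
      using residual_is_topology[OF J] by (simp add: topology_imp_eq_residual[OF J])
    fix J' assume "grothendieck_topology C J'"
    then show "J1 \<inter> J' \<subseteq> J2 \<longleftrightarrow> J' \<subseteq> topology_imp C J1 J2"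
      using residual_adjunction[OF J(1)] by (simp add: topology_imp_eq_residual[OF J])
  next
    fix J1 J2 X and I :: "'u set" and x
    assume J: "grothendieck_topology C J1" "grothendieck_topology C J2"
      and x: "is_family C X I x"
    show "covering_family C (topology_imp C J1 J2) X I x \<longleftrightarrow>
              (\<forall>X'. \<forall>y \<in> Hom C X' X. \<forall>(K :: 'u set) x'.
                 covering_family C J1 X' K x' \<longrightarrow>
                 (\<forall>X''. \<forall>f \<in> Hom C X'' X'.
                    (\<exists>i \<in> I. \<exists>g \<in> Hom C X'' (Dom C (x i)). Comp C (x i) g = Comp C y f) \<longrightarrow>
                    (\<exists>k \<in> K. \<exists>h \<in> Hom C X'' (Dom C (x' k)). f = Comp C (x' k) h)) \<longrightarrow>
                 covering_family C J2 X' K x')"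
      unfolding topology_imp_eq_residual[OF J]
        covering_family_residual_iff[OF assms(2) J(1) x]
      by (intro all_cong1 ball_cong imp_cong refl,
          rule square_condition_iff_pullback_subset[OF x, symmetric])
        (simp_all add: covering_family_def)
  qed
qed

end
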